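(* Let $\alpha,\beta\in(0,1)$ be such that at least one of them is irrational. Then for $\mathbb{P}$-almost all $\mathbf{x}\in\Sigma$ the sequence $S_n(\mathbf{x})$, $n\in\mathbb{N}$, is uniformly distributed modulo one.
   Context: $\Sigma=\{1,2\}^{\mathbb{N}}$ is the set of sequences $\mathbf{x}=(x_1,x_2,\ldots)$ with $x_n\in\{1,2\}$, and $\mathbb{P}$ is the product probability measure on $\Sigma$ under which the coordinates $x_i$ are independent and each takes the values $1$ and $2$ with probability $1/2$. For $\mathbf{x}\in\Sigma$ and $i,n\in\mathbb{N}=\{1,2,\ldots\}$ put $X_i(\mathbf{x})=\alpha$ if $x_i=1$, $X_i(\mathbf{x})=\beta$ if $x_i=2$, and $S_n(\mathbf{x})=\sum_{i=1}^n X_i(\mathbf{x})$. A sequence of real numbers $\xi_n$, $n\in\mathbb{N}$, is uniformly distributed modulo one if for every interval $I\subseteq[0,1)$ one has $\frac{1}{N}\#\{1\le n\le N:\{\xi_n\}\in I\}\to|I|$ as $N\to\infty$, where $\{x\}$ is the fractional part of $x$ and $|I|$ is the length of $I$. *)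

theory Defs
  imports "HOL-Probability.Probability"
begin

text \<open>
  Sequences are indexed by the positive integers, encoded as the index set \<open>{1..}\<close> in \<^typ>\<open>nat\<close>.
  So \<open>\<Sigma>\<close> is the extensional function space \<open>{1..} \<rightarrow>\<^sub>E {1,2}\<close>; it is the space of the
  product measure below.
\<close>

definition Sigma12 :: "(nat \<Rightarrow> nat) set" where
  "Sigma12 = {1..} \<rightarrow>\<^sub>E {1, 2}"

definition coin_measure :: "(nat \<Rightarrow> nat) measure" where
  "coin_measure = PiM {1..} (\<lambda>_. uniform_count_measure {1, 2})"

lemma space_coin_measure: "space coin_measure = Sigma12"
  by (simp add: coin_measure_def Sigma12_def space_PiM space_uniform_count_measure)

definition step :: "real \<Rightarrow> real \<Rightarrow> nat \<Rightarrow> (nat \<Rightarrow> nat) \<Rightarrow> real" where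
  "step \<alpha> \<beta> i x = (if x i = 1 then \<alpha> else \<beta>)"

definition partial_sum :: "real \<Rightarrow> real \<Rightarrow> nat \<Rightarrow> (nat \<Rightarrow> nat) \<Rightarrow> real" where
  "partial_sum \<alpha> \<beta> n x = (\<Sum>i=1..n. step \<alpha> \<beta> i x)"

text \<open>
  Intervals may be open, closed, half-open, degenerate or empty; the length of \<open>I\<close> is its
  Lebesgue measure. The value \<open>\<xi> 0\<close> is never used.
\<close>

definition uniformly_distributed_mod_one :: "(nat \<Rightarrow> real) \<Rightarrow> bool" where
  "uniformly_distributed_mod_one \<xi> \<longleftrightarrow>
     (\<forall>I. is_interval I \<and> I \<subseteq> {0..<1} \<longrightarrow>
        (\<lambda>N. real (card {n \<in> {1..N}. frac (\<xi> n) \<in> I}) / real N)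
          \<longlonglongrightarrow> measure lborel I)"

end

theory Submission
  imports Defs "HOL-Library.Discrete_Functions"
begin

text \<open>
  For an integer \<open>h \<noteq> 0\<close> let \<open>\<phi> = (exp (2\<pi>ih\<alpha>) + exp (2\<pi>ih\<beta>)) / 2\<close>. Irrationality of \<open>\<alpha>\<close> or \<open>\<beta>\<close> gives
  \<open>\<phi> \<noteq> 1\<close> (although \<open>|\<phi>| = 1\<close> is possible), and the correlation of the \<open>n\<close>th and \<open>m\<close>th terms of the
  Weyl sum is \<open>\<phi>\<close> to the power \<open>m - n\<close>. These geometric sums are bounded, so the second moment of the
  \<open>N\<close>th Weyl sum is \<open>O(N)\<close>. The averages therefore tend to zero almost surely along \<open>N = m\<^sup>2\<close>, hence along
  all \<open>N\<close> since the gaps have length \<open>O(m)\<close>, and Weyl's criterion applies.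
\<close>

subsection \<open>Weyl's criterion\<close>

text \<open>Multiplication is left out of the rules because limits of averages are linear but not
  multiplicative. Inductions over this predicate thus meet only characters, sums and scalar
  multiples, and closure under products is derived separately.\<close>

inductive trigonometric_polynomial :: "(real \<Rightarrow> complex) \<Rightarrow> bool" where
  character: "trigonometric_polynomial (\<lambda>t. cis (2 * pi * of_int h * t))"
| add: "trigonometric_polynomial f \<Longrightarrow> trigonometric_polynomial g \<Longrightarrow>
    trigonometric_polynomial (\<lambda>t. f t + g t)"
| scale: "trigonometric_polynomial f \<Longrightarrow> trigonometric_polynomial (\<lambda>t. c * f t)"

lemma trigonometric_polynomial_mult:
  assumes "trigonometric_polynomial f" "trigonometric_polynomial g"
  shows "trigonometric_polynomial (\<lambda>t. f t * g t)"
  using assms(1)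
proof induction
  case (character h)
  show ?case using assms(2)
  proof induction
    case (character k)
    then show ?case
      using trigonometric_polynomial.character[of "h + k"] by (simp add: cis_mult algebra_simps)
  next
    case (add f g)
    then show ?case
      using trigonometric_polynomial.add by (fastforce simp: distrib_left)
  next
    case (scale f c)
    then show ?case
      using trigonometric_polynomial.scale[OF scale.IH, of c] by (simp add: mult_ac)
  qed
next
  case (add f1 f2)
  then show ?case
    using trigonometric_polynomial.add[OF add.IH] by (simp add: distrib_right)
next
  case (scale f c)
  then show ?case
    using trigonometric_polynomial.scale[OF scale.IH, of c] by (simp add: mult_ac)
qed

lemma trigonometric_polynomial_const: "trigonometric_polynomial (\<lambda>t. c)"
  using trigonometric_polynomial.scale[OF trigonometric_polynomial.character[of 0], of c] by simp

text \<open>Links the function class of the Stone-Weierstrass theorem to characters: it is generated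
  by constants and real-linear functionals, and a functional on the circle is a combination of
  cosine and sine.\<close>

lemma trigonometric_polynomial_of_real_polynomial_function:
  fixes p :: "complex \<Rightarrow> real"
  assumes "real_polynomial_function p"
  shows "trigonometric_polynomial (\<lambda>t. of_real (p (cis (2 * pi * t))))"
  using assms
proof induction
  case (linear f)
  let ?e = "\<lambda>h::int. \<lambda>t::real. cis (2 * pi * of_int h * t)"
  interpret bounded_linear f by fact
  \<comment> \<open>Euler's formulas for cosine and sine, inserted into cos * \<open>f 1\<close> +
    sin * \<open>f \<i>\<close>, give these coefficients.\<close>
  have "complex_of_real (f (cis (2 * pi * t)))
      = (f 1 - \<i> * f \<i>) / 2 * ?e 1 t + (f 1 + \<i> * f \<i>) / 2 * ?e (-1) t" for t
  proof -
    have "f (cis (2 * pi * t)) = f (cos (2 * pi * t) *\<^sub>R 1 + sin (2 * pi * t) *\<^sub>R \<i>)"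
      by (rule arg_cong[where f = f]) (simp add: complex_eq_iff)
    also have "\<dots> = cos (2 * pi * t) * f 1 + sin (2 * pi * t) * f \<i>"
      by (simp only: add scaleR) simp
    finally show ?thesis by (simp add: complex_eq_iff field_simps)
  qed
  then show ?case
    by (simp only:) (intro trigonometric_polynomial.intros)
next
  case (mult f g)
  then show ?case using trigonometric_polynomial_mult by fastforce
next
  case (add f g)
  then show ?case using trigonometric_polynomial.add by fastforce
next
  case (const c)
  then show ?case by (rule trigonometric_polynomial_const)
qed

lemma has_integral_character:
  fixes h :: int
  shows "((\<lambda>t. cis (2 * pi * h * t)) has_integral (if h = 0 then 1 else 0)) {0..1}"
proof (cases "h = 0")
  case True
  then show ?thesis using has_integral_const_real[of "1::complex" 0 1] by simp
next
  case False
  define c where "c = 2 * pi * h * \<i>"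
  have "c \<noteq> 0" using False by (simp add: c_def)
  have cis_eq: "cis (2 * pi * h * t) = exp (c * of_real t)" for t
    by (simp add: cis_conv_exp c_def mult_ac)
  let ?F = "\<lambda>t::real. exp (c * of_real t) / c"
  have "((\<lambda>t. cis (2 * pi * h * t)) has_integral (?F 1 - ?F 0)) {0..1}"
  proof (rule fundamental_theorem_of_calculus)
    fix t :: real
    show "(?F has_vector_derivative cis (2 * pi * h * t)) (at t within {0..1})"
      unfolding cis_eq using \<open>c \<noteq> 0\<close>
      by (intro has_vector_derivative_real_field) (auto intro!: derivative_eq_intros)
  qed auto
  \<comment> \<open>Integrality of \<open>h\<close> enters here: the antiderivative has period
    one.\<close>
  moreover have "?F 1 = ?F 0"
    using cis_eq[of 1] cis_eq[of 0] by (simp add: cis_multiple_2pi)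
  ultimately show ?thesis using False by (simp only: diff_self if_False)
qed

section \<open>Visit frequencies\<close>

definition frequency :: "(nat \<Rightarrow> real) \<Rightarrow> real set \<Rightarrow> nat \<Rightarrow> real" where
  "frequency \<xi> I N = real (card {n \<in> {1..N}. frac (\<xi> n) \<in> I}) / real N"

lemma frequency_disjoint:
  assumes "I \<inter> J = {}"
  shows "frequency \<xi> (I \<union> J) N = frequency \<xi> I N + frequency \<xi> J N"
proof -
  have "{n \<in> {1..N}. frac (\<xi> n) \<in> I \<union> J} = {n \<in> {1..N}. frac (\<xi> n) \<in> I} \<union> {n \<in> {1..N}. frac (\<xi> n) \<in> J}"
    by auto
  moreover have "card ({n \<in> {1..N}. frac (\<xi> n) \<in> I} \<union> {n \<in> {1..N}. frac (\<xi> n) \<in> J})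
    = card {n \<in> {1..N}. frac (\<xi> n) \<in> I} + card {n \<in> {1..N}. frac (\<xi> n) \<in> J}"
    using assms by (intro card_Un_disjoint) auto
  ultimately show ?thesis by (simp add: frequency_def add_divide_distrib)
qed

lemma frequency_mono: "I \<subseteq> J \<Longrightarrow> frequency \<xi> I N \<le> frequency \<xi> J N"
  unfolding frequency_def by (intro divide_right_mono of_nat_mono card_mono) auto

lemma frequency_le_1: "frequency \<xi> I N \<le> 1"
proof -
  have "card {n \<in> {1..N}. frac (\<xi> n) \<in> I} \<le> card {1..N}" by (intro card_mono) auto
  then show ?thesis by (simp add: frequency_def divide_le_eq)
qed

section \<open>Limits of averages for a fixed sequence with vanishing Weyl sums\<close>

context
  fixes \<xi> :: "nat \<Rightarrow> real"
  assumes Weyl_sums: "\<And>h::int. h \<noteq> 0 \<Longrightarrow>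
    (\<lambda>N. (\<Sum>n=1..N. cis (2 * pi * h * \<xi> n)) / of_nat N) \<longlonglongrightarrow> 0"
begin

lemma average_trigonometric_polynomial:
  assumes "trigonometric_polynomial f"
  shows "\<exists>c. (f has_integral c) {0..1} \<and> (\<lambda>N. (\<Sum>n=1..N. f (\<xi> n)) / of_nat N) \<longlonglongrightarrow> c"
  using assms
proof induction
  case (character h)
  have "(\<lambda>N. (\<Sum>n=1..N. cis (2 * pi * h * \<xi> n)) / of_nat N) \<longlonglongrightarrow> (if h = 0 then 1 else 0)"
  proof (cases "h = 0")
    case True
    \<comment> \<open>The quotient is 0 at N = 0 and 1 from N = 1 on.\<close>
    have "(\<lambda>N. of_nat N / of_nat N :: complex) \<longlonglongrightarrow> 1"
      by (rule tendsto_eventually) (auto intro: eventually_sequentiallyI[of 1])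
    then show ?thesis using True by simp
  next
    case False
    then show ?thesis using Weyl_sums[of h] by simp
  qed
  then show ?case using has_integral_character by blast
next
  case (add f g)
  then obtain c d where "(f has_integral c) {0..1}" "(g has_integral d) {0..1}"
    "(\<lambda>N. (\<Sum>n=1..N. f (\<xi> n)) / of_nat N) \<longlonglongrightarrow> c" "(\<lambda>N. (\<Sum>n=1..N. g (\<xi> n)) / of_nat N) \<longlonglongrightarrow> d"
    by blast
  then show ?case
    by (intro exI[of _ "c + d"] conjI has_integral_add)
      (simp_all add: sum.distrib add_divide_distrib tendsto_add)
next
  case (scale f c)
  then obtain d where d: "(f has_integral d) {0..1}"
    "(\<lambda>N. (\<Sum>n=1..N. f (\<xi> n)) / of_nat N) \<longlonglongrightarrow> d"
    by blast
  then show ?case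
    using tendsto_mult[OF tendsto_const[of c] d(2)]
    by (intro exI[of _ "c * d"] conjI has_integral_mult_right)
      (simp_all add: sum_distrib_left)
qed

text \<open>Uniform approximation by a polynomial \<open>p\<close> leaves three errors of size r/3:
  between the averages of \<open>f\<close> and \<open>p\<close>, between the average of
  \<open>p\<close> and its integral, and between the two integrals.\<close>

lemma average_continuous_function:
  fixes f :: "complex \<Rightarrow> real"
  assumes f: "continuous_on (sphere 0 1) f"
  shows "(\<lambda>N. (\<Sum>n=1..N. f (cis (2 * pi * \<xi> n))) / real N) \<longlonglongrightarrow> integral {0..1} (\<lambda>t. f (cis (2 * pi * t)))"
proof (rule LIMSEQ_I)
  fix r :: real assume "r > 0"
  define d where "d = r / 3"
  have "d > 0" using \<open>r > 0\<close> by (simp add: d_def)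
  then obtain p where p: "real_polynomial_function p" "\<And>z. z \<in> sphere 0 1 \<Longrightarrow> \<bar>f z - p z\<bar> < d"
    using Stone_Weierstrass_real_polynomial_function[OF compact_sphere f] by metis
  let ?f = "\<lambda>t. f (cis (2 * pi * t))" and ?p = "\<lambda>t. p (cis (2 * pi * t))"
  let ?av = "\<lambda>g N. (\<Sum>n=1..N. g (\<xi> n)) / real N"
  have fp: "\<bar>?f t - ?p t\<bar> \<le> d" for t using p(2)[of "cis (2 * pi * t)"] by (simp add: dist_norm)
  have contf: "continuous_on {0..1} ?f"
    by (rule continuous_on_compose2[OF f]) (auto intro!: continuous_intros simp: dist_norm)
  obtain c where c: "((\<lambda>t. complex_of_real (?p t)) has_integral c) {0..1}"
    "(\<lambda>N. (\<Sum>n=1..N. complex_of_real (?p (\<xi> n))) / of_nat N) \<longlonglongrightarrow> c"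
    using average_trigonometric_polynomial[OF trigonometric_polynomial_of_real_polynomial_function[OF p(1)]]
    by blast
  have intp: "(?p has_integral Re c) {0..1}"
    using has_integral_linear[OF c(1) bounded_linear_Re] by (simp add: o_def)
  have limp: "?av ?p \<longlonglongrightarrow> Re c"
  proof -
    have "(\<Sum>n=1..N. complex_of_real (?p (\<xi> n))) / of_nat N = complex_of_real (?av ?p N)" for N
      by simp
    then show ?thesis
      using tendsto_Re[OF c(2)] by (simp only: Re_complex_of_real)
  qed
  have intf: "\<bar>integral {0..1} ?f - Re c\<bar> \<le> d"
  proof -
    have "((\<lambda>t. ?f t - ?p t) has_integral (integral {0..1} ?f - Re c)) {0..1}"
      by (intro has_integral_diff intp integrable_integral integrable_continuous_real contf)
    from has_integral_bound_real[OF _ finite.emptyI this, of d] fp \<open>d > 0\<close> show ?thesis by simp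
  qed
  have avf: "\<bar>?av ?f N - ?av ?p N\<bar> \<le> d" for N
  proof -
    have "\<bar>\<Sum>n=1..N. ?f (\<xi> n) - ?p (\<xi> n)\<bar> \<le> (\<Sum>n=1..N. d)"
      by (rule order_trans[OF sum_abs sum_mono]) (rule fp)
    then have "\<bar>(\<Sum>n=1..N. ?f (\<xi> n) - ?p (\<xi> n)) / real N\<bar> \<le> d"
      using \<open>d > 0\<close> by (cases "N = 0") (auto simp: abs_divide divide_le_eq mult.commute)
    then show ?thesis by (simp add: sum_subtractf diff_divide_distrib)
  qed
  obtain N0 where N0: "\<And>N. N \<ge> N0 \<Longrightarrow> \<bar>?av ?p N - Re c\<bar> < d"
    using LIMSEQ_D[OF limp \<open>d > 0\<close>] by auto
  have "norm (?av ?f N - integral {0..1} ?f) < r" if "N \<ge> N0" for N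
    using N0[OF that] avf[of N] intf unfolding d_def real_norm_def by linarith
  then show "\<exists>N0. \<forall>N\<ge>N0. norm (?av ?f N - integral {0..1} ?f) < r" by blast
qed

section \<open>From continuous functions to intervals\<close>

text \<open>Continuous functions below the indicator, with integral close to b - a, bound the
  frequency from below. No approximation from above is constructed; the matching upper bound comes
  from complements.\<close>

lemma frequency_open_interval_lower:
  assumes ab: "0 \<le> a" "a \<le> b" "b \<le> 1" and d: "d > 0"
  shows "eventually (\<lambda>N. frequency \<xi> {a<..<b} N > b - a - d) sequentially"
proof -
  \<comment> \<open>On the circle, \<open>q\<close> is positive exactly on the open arc from \<open>a\<close> to \<open>b\<close>, so the continuous
    functions \<open>F k\<close> increase to the indicator of that arc.\<close>
  define q where "q z = (Re (z * cis (- pi * (a + b))) - cos (pi * (b - a))) / 2" for z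
  define F where "F k z = min 1 (max 0 (real k * q z))" for k :: nat and z
  \<comment> \<open>The product-to-sum formula: the definition shows that \<open>q\<close> is
    continuous on the circle, the product of sines shows its sign.\<close>
  have q: "q (cis (2 * pi * t)) = sin (pi * (t - a)) * sin (pi * (b - t))" for t
  proof -
    have "pi * (t - a) - pi * (b - t) = 2 * pi * t + - pi * (a + b)"
      "pi * (t - a) + pi * (b - t) = pi * (b - a)"
      by (simp_all add: algebra_simps)
    then show ?thesis unfolding q_def cis_mult sin_times_sin by simp
  qed
  have sin_pos: "sin (pi * u) > 0" if "0 < u" "u < 1" for u
    using that mult_strict_left_mono[of u 1 pi] by (intro sin_gt_zero) auto
  have sin_nonneg: "sin (pi * u) \<ge> 0" if "0 \<le> u" "u \<le> 1" for u
    using that mult_left_mono[of u 1 pi] by (intro sin_ge_zero) auto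
  have sin_nonpos: "sin (pi * u) \<le> 0" if "- 1 \<le> u" "u \<le> 0" for u
    using sin_nonneg[of "- u"] that by simp
  have q_pos: "q (cis (2 * pi * t)) > 0" if "a < t" "t < b" for t
    unfolding q using that ab by (intro mult_pos_pos sin_pos) auto
  have q_nonpos: "q (cis (2 * pi * t)) \<le> 0" if "0 \<le> t" "t \<le> 1" "\<not> (a < t \<and> t < b)" for t
  proof (cases "t \<le> a")
    case True
    then show ?thesis
      unfolding q using ab that by (intro mult_nonpos_nonneg sin_nonneg sin_nonpos) auto
  next
    case False
    then show ?thesis
      unfolding q using ab that by (intro mult_nonneg_nonpos sin_nonneg sin_nonpos) auto
  qed
  have contF: "continuous_on S (F k)" for k S
    unfolding F_def q_def by (intro continuous_intros) auto
  have F_le: "F k (cis (2 * pi * t)) \<le> indicator {a<..<b} t" if "0 \<le> t" "t \<le> 1" for t k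
  proof (cases "a < t \<and> t < b")
    case True
    then show ?thesis by (simp add: F_def)
  next
    case False
    then have "real k * q (cis (2 * pi * t)) \<le> 0"
      by (intro mult_nonneg_nonpos q_nonpos that) simp
    then show ?thesis by (simp add: F_def)
  qed
  have F_lim: "(\<lambda>k. F k (cis (2 * pi * t))) \<longlonglongrightarrow> indicator {a<..<b} t" if t: "t \<in> {0..1}" for t
  proof (cases "a < t \<and> t < b")
    case True
    define s where "s = q (cis (2 * pi * t))"
    have "s > 0" using q_pos True by (simp add: s_def)
    obtain k0 :: nat where k0: "1 / s \<le> real k0" using real_arch_simple by blast
    have "F k (cis (2 * pi * t)) = 1" if "k \<ge> k0" for k
    proof -
      have "1 / s \<le> real k" using k0 that by linarith
      then have "real k * s \<ge> 1" using \<open>s > 0\<close> by (simp add: field_simps)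
      then show ?thesis by (simp add: F_def s_def[symmetric])
    qed
    then have "\<forall>\<^sub>F k in sequentially. F k (cis (2 * pi * t)) = 1"
      by (rule eventually_sequentiallyI)
    then show ?thesis using True by (auto intro: tendsto_eventually)
  next
    case False
    then have "real k * q (cis (2 * pi * t)) \<le> 0" for k
      using t by (intro mult_nonneg_nonpos q_nonpos) auto
    then have "F k (cis (2 * pi * t)) = 0" for k
      by (simp add: F_def max_absorb1)
    then show ?thesis using False by auto
  qed
  have F_int: "(\<lambda>k. integral {0..1} (\<lambda>t. F k (cis (2 * pi * t)))) \<longlonglongrightarrow> integral {0..1} (indicator {a<..<b})"
  proof (rule dominated_convergence(2)[where h = "\<lambda>_. 1"])
    show "(\<lambda>t. F k (cis (2 * pi * t))) integrable_on {0..1}" for k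
      by (intro integrable_continuous_real continuous_on_compose2[OF contF[of UNIV]] continuous_intros) auto
    show "norm (F k (cis (2 * pi * t))) \<le> 1" for k t
      by (simp add: F_def)
    show "(\<lambda>_. 1::real) integrable_on {0..1::real}" by (rule integrable_const_ivl)
  qed (rule F_lim)
  have "integral {0..1} (indicator {a<..<b} :: real \<Rightarrow> real) = b - a"
  proof -
    have "((\<lambda>_. 1::real) has_integral (b - a)) {a..b}"
      using has_integral_const_real[of "1::real" a b] ab by simp
    then have "((\<lambda>_. 1::real) has_integral (b - a)) {a<..<b}"
      by (simp only: has_integral_Icc_iff_Ioo)
    moreover have "{a<..<b} \<subseteq> {0..1}" using ab by auto
    ultimately have "((\<lambda>x. if x \<in> {a<..<b} then 1 else 0::real) has_integral (b - a)) {0..1}"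
      by (simp only: has_integral_restrict)
    moreover have "(\<lambda>x. if x \<in> {a<..<b} then 1 else 0::real) = indicator {a<..<b}"
      by (simp add: fun_eq_iff indicator_def)
    ultimately show ?thesis by (simp only: integral_unique)
  qed
  then have "\<forall>\<^sub>F k in sequentially. integral {0..1} (\<lambda>t. F k (cis (2 * pi * t))) > b - a - d"
    using d by (intro order_tendstoD(1)[OF F_int]) simp
  \<comment> \<open>This \<open>k\<close> is fixed before N grows, so no uniformity in
    \<open>k\<close> is required.\<close>
  then obtain k where k: "integral {0..1} (\<lambda>t. F k (cis (2 * pi * t))) > b - a - d"
    by (auto simp: eventually_sequentially)
  have "\<forall>\<^sub>F N in sequentially. (\<Sum>n=1..N. F k (cis (2 * pi * \<xi> n))) / real N > b - a - d"
    using average_continuous_function[OF contF] k by (rule order_tendstoD)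
  then show ?thesis
  proof eventually_elim
    case (elim N)
    \<comment> \<open>Dropping the integer part removes full turns only, so estimates on [0,1] apply
      to every term.\<close>
    have "cis (2 * pi * frac t) = cis (2 * pi * t)" for t
    proof -
      have "cis (2 * pi * t) = cis (2 * pi * frac t) * cis (2 * pi * of_int \<lfloor>t\<rfloor>)"
        unfolding cis_mult by (simp add: frac_def algebra_simps)
      then show ?thesis by (simp add: cis_multiple_2pi)
    qed
    then have "F k (cis (2 * pi * \<xi> n)) \<le> indicator {a<..<b} (frac (\<xi> n))" for n
      using F_le[of "frac (\<xi> n)" k] by (simp add: frac_ge_0 less_imp_le[OF frac_lt_1])
    then have "(\<Sum>n=1..N. F k (cis (2 * pi * \<xi> n))) \<le> (\<Sum>n=1..N. indicator {a<..<b} (frac (\<xi> n)))"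
      by (rule sum_mono)
    also have "\<dots> = card {n \<in> {1..N}. frac (\<xi> n) \<in> {a<..<b}}"
      by (simp add: indicator_def of_bool_def sum.If_cases Int_def)
    finally show ?case using elim unfolding frequency_def
      by (meson divide_right_mono less_le_trans of_nat_0_le_iff)
  qed
qed

lemma frequency_tendsto:
  assumes ab: "0 \<le> a" "a \<le> b" "b \<le> 1" and I: "{a<..<b} \<subseteq> I" "I \<subseteq> {a..b}"
  shows "frequency \<xi> I \<longlonglongrightarrow> b - a"
proof (rule LIMSEQ_I)
  fix r :: real assume "r > 0"
  then have r: "r / 2 > 0" by simp
  \<comment> \<open>Lower bounds on the complementary intervals give the upper bound on \<open>I\<close>.\<close>
  have left: "\<forall>\<^sub>F N in sequentially. frequency \<xi> {0<..<a} N > a - 0 - r / 2"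
    and right: "\<forall>\<^sub>F N in sequentially. frequency \<xi> {b<..<1} N > 1 - b - r / 2"
    using ab r by (intro frequency_open_interval_lower; simp)+
  have "\<forall>\<^sub>F N in sequentially. norm (frequency \<xi> I N - (b - a)) < r"
    using frequency_open_interval_lower[OF ab \<open>r > 0\<close>] left right
  proof eventually_elim
    case (elim N)
    \<comment> \<open>The disjoint pieces may miss the points 0, a and b, but a total of at most 1
      suffices. The two errors r/2 then add up to r.\<close>
    have "frequency \<xi> {0<..<a} N + frequency \<xi> I N + frequency \<xi> {b<..<1} N
        = frequency \<xi> ({0<..<a} \<union> I \<union> {b<..<1}) N"
      using I ab by (subst frequency_disjoint, fastforce)+ simp
    also have "\<dots> \<le> 1" by (rule frequency_le_1)
    finally show ?case using elim ab frequency_mono[OF I(1), of \<xi> N] by (simp add: abs_less_iff)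
  qed
  then show "\<exists>N0. \<forall>N\<ge>N0. norm (frequency \<xi> I N - (b - a)) < r"
    by (simp add: eventually_sequentially)
qed

text \<open>A nonempty interval lies between the open and the closed interval with endpoints
  \<open>Inf I\<close> and \<open>Sup I\<close>, hence differs from the open one by a null set of at
  most two points.\<close>

lemma Weyl_criterion: "uniformly_distributed_mod_one \<xi>"
  unfolding uniformly_distributed_mod_one_def
proof (intro allI impI, elim conjE)
  fix I :: "real set" assume I: "is_interval I" "I \<subseteq> {0..<1}"
  show "(\<lambda>N. real (card {n \<in> {1..N}. frac (\<xi> n) \<in> I}) / real N) \<longlonglongrightarrow> measure lborel I"
  proof (cases "I = {}")
    case False
    obtain a b where ab: "0 \<le> a" "a \<le> b" "b \<le> 1" "{a<..<b} \<subseteq> I" "I \<subseteq> {a..b}"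
      "measure lborel I = b - a"
    proof
      have bdd: "bdd_below I" "bdd_above I"
        by (rule bdd_below_mono[OF bdd_below_Ico I(2)], rule bdd_above_mono[OF bdd_above_Ico I(2)])
      show *: "I \<subseteq> {Inf I..Sup I}"
        using bdd by (auto intro: cInf_lower cSup_upper)
      show "{Inf I<..<Sup I} \<subseteq> I"
      proof
        fix x assume "x \<in> {Inf I<..<Sup I}"
        then obtain y z where "y \<in> I" "y < x" "z \<in> I" "x < z"
          using False bdd by (auto simp: cInf_less_iff less_cSup_iff)
        then show "x \<in> I" using I(1) unfolding is_interval_1 by (meson less_imp_le)
      qed
      show "0 \<le> Inf I" using I(2) False by (intro cInf_greatest) auto
      show "Sup I \<le> 1" using I(2) False by (intro cSup_least) auto
      show "Inf I \<le> Sup I" using * False by fastforce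
      show "measure lborel I = Sup I - Inf I"
      proof -
        have "emeasure lborel I = emeasure lborel {Inf I<..<Sup I}"
        proof (rule emeasure_eq_AE)
          show "AE x in lborel. x \<in> I \<longleftrightarrow> x \<in> {Inf I<..<Sup I}"
            using AE_lborel_singleton[of "Inf I"] AE_lborel_singleton[of "Sup I"]
          proof eventually_elim
            case (elim x)
            then show ?case using * \<open>{Inf I<..<Sup I} \<subseteq> I\<close> by force
          qed
          show "I \<in> sets lborel" using real_interval_borel_measurable[OF I(1)] by simp
        qed auto
        then show ?thesis using \<open>Inf I \<le> Sup I\<close> by (simp add: measure_def)
      qed
    qed
    then show ?thesis using frequency_tendsto[OF ab(1-5)] unfolding frequency_def by (simp only: ab(6))
  qed simp
qed

end

subsection \<open>Averages of partial products of independent unit complex numbers\<close>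

text \<open>For m the integer square root of N, the sum up to N has at most 2m terms beyond m^2.
  Dividing by m^2 instead of N costs an error of at most 2/m.\<close>

lemma averages_tendsto_zero_if_square_subsequence:
  fixes w :: "nat \<Rightarrow> complex"
  assumes w: "\<And>n. norm (w n) \<le> 1"
    and squares: "(\<lambda>m. (\<Sum>n=1..m\<^sup>2. w n) / of_nat (m\<^sup>2)) \<longlonglongrightarrow> 0"
  shows "(\<lambda>N. (\<Sum>n=1..N. w n) / of_nat N) \<longlonglongrightarrow> 0"
proof -
  define A where "A N = (\<Sum>n=1..N. w n)" for N
  \<comment> \<open>Monotonicity and the value k at k^2 force divergence.\<close>
  have fs: "filterlim floor_sqrt at_top sequentially"
    unfolding filterlim_at_top eventually_sequentially
    by (metis floor_sqrt_inverse_power2 mono_floor_sqrt')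
  have bound: "norm (A N / of_nat N)
      \<le> norm (A ((floor_sqrt N)\<^sup>2) / of_nat ((floor_sqrt N)\<^sup>2)) + 2 / real (floor_sqrt N)"
    if "N \<ge> 1" for N
  proof -
    define m where "m = floor_sqrt N"
    have m1: "m \<ge> 1" using that by (simp add: m_def Suc_le_eq)
    have m2: "m\<^sup>2 \<le> N" by (simp add: m_def)
    have m3: "N < (Suc m)\<^sup>2"
      unfolding m_def by (rule Suc_floor_sqrt_power2_gt)
    have "A N = A (m\<^sup>2) + (\<Sum>n\<in>{m\<^sup>2<..N}. w n)"
      unfolding A_def using m2 
      by (subst sum.union_disjoint[symmetric]) (auto intro!: sum.cong)
    moreover have "norm (\<Sum>n\<in>{m\<^sup>2<..N}. w n) \<le> real (N - m\<^sup>2)"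
      using sum_norm_le[of "{m\<^sup>2<..N}" w "\<lambda>_. 1"] w by simp
    moreover have "real (N - m\<^sup>2) \<le> real (2 * m)"
      unfolding of_nat_le_iff using m3 by (simp add: power2_eq_square)
    ultimately have 1: "norm (A N) \<le> norm (A (m\<^sup>2)) + 2 * real m"
      using norm_triangle_ineq[of "A (m\<^sup>2)" "\<Sum>n\<in>{m\<^sup>2<..N}. w n"] by simp
    have "norm (A N / of_nat N) \<le> norm (A N) / real (m\<^sup>2)"
      unfolding norm_divide norm_of_nat using m1 m2 that
      by (intro divide_left_mono) (auto simp del: of_nat_power intro!: mult_pos_pos)
    also have "\<dots> \<le> (norm (A (m\<^sup>2)) + 2 * real m) / real (m\<^sup>2)"
      using 1 by (intro divide_right_mono) auto
    also have "\<dots> = norm (A (m\<^sup>2) / of_nat (m\<^sup>2)) + 2 / real m"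
      using m1 by (simp add: norm_divide norm_mult field_simps power2_eq_square)
    finally show ?thesis by (simp add: m_def)
  qed
  have "(\<lambda>m. norm (A (m\<^sup>2) / of_nat (m\<^sup>2)) + 2 / real m) \<longlonglongrightarrow> 0 + 0"
    using tendsto_norm_zero[OF squares] unfolding A_def
    by (intro tendsto_add lim_const_over_n) simp
  from filterlim_compose[OF this fs]
  have "(\<lambda>N. norm (A ((floor_sqrt N)\<^sup>2) / of_nat ((floor_sqrt N)\<^sup>2)) + 2 / real (floor_sqrt N)) \<longlonglongrightarrow> 0"
    by simp
  then show ?thesis
    unfolding A_def[symmetric]
    by (rule Lim_null_comparison[rotated]) (rule eventually_sequentiallyI[of 1], rule bound)
qed

text \<open>The geometric sum is divided by 1 - z rather than 1 - |z|, so the bound is uniform in N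
  even for |z| = 1. The reversed exponents are those of the correlations of term N + 1 with the
  earlier ones.\<close>

lemma norm_sum_powers_le:
  fixes z :: complex
  assumes "norm z \<le> 1" "z \<noteq> 1"
  shows "norm (\<Sum>n=1..N. z ^ (Suc N - n)) \<le> 2 / norm (1 - z)"
proof -
  have "(\<Sum>n=1..N. z ^ (Suc N - n)) = (\<Sum>n=1..N. z ^ n)"
    by (rule sum.reindex_bij_witness[of _ "\<lambda>n. Suc N - n" "\<lambda>n. Suc N - n"]) auto
  also have "\<dots> = (z - z ^ Suc N) / (1 - z)"
    using assms sum_gp[of z 1 N] by auto
  finally have "norm (\<Sum>n=1..N. z ^ (Suc N - n)) = norm (z - z ^ Suc N) / norm (1 - z)"
    by (simp add: norm_divide)
  moreover have "norm (z - z ^ Suc N) \<le> norm z + norm (z ^ Suc N)" by (rule norm_triangle_ineq4)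
  moreover have "norm (z ^ Suc N) \<le> 1"
    unfolding norm_power using assms by (intro power_le_one) auto
  ultimately show ?thesis using assms(1)
    by (auto intro!: divide_right_mono)
qed

section \<open>Second moments and almost sure convergence\<close>

text \<open>By Tonelli the series of squared norms has finite expectation, so it converges almost
  surely and its terms vanish in the limit.\<close>

lemma (in prob_space) AE_tendsto_zero_if_summable_second_moments:
  fixes Y :: "nat \<Rightarrow> 'a \<Rightarrow> complex"
  assumes [measurable]: "\<And>n. Y n \<in> borel_measurable M"
    and int: "\<And>n. integrable M (\<lambda>x. (norm (Y n x))\<^sup>2)"
    and sum: "summable (\<lambda>n. expectation (\<lambda>x. (norm (Y n x))\<^sup>2))"
  shows "AE x in M. (\<lambda>n. Y n x) \<longlonglongrightarrow> 0"
proof -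
  have "(\<integral>\<^sup>+x. (\<Sum>n. ennreal ((norm (Y n x))\<^sup>2)) \<partial>M)
      = (\<Sum>n. \<integral>\<^sup>+x. ennreal ((norm (Y n x))\<^sup>2) \<partial>M)"
    by (rule nn_integral_suminf) measurable
  also have "\<dots> = (\<Sum>n. ennreal (expectation (\<lambda>x. (norm (Y n x))\<^sup>2)))"
    by (intro suminf_cong nn_integral_eq_integral int) auto
  also have "\<dots> \<noteq> \<infinity>"
    using sum by (simp add: suminf_ennreal2)
  finally have "AE x in M. (\<Sum>n. ennreal ((norm (Y n x))\<^sup>2)) \<noteq> \<infinity>"
    by (intro nn_integral_PInf_AE) auto
  then show ?thesis
  proof eventually_elim
    case (elim x)
    then have "summable (\<lambda>n. (norm (Y n x))\<^sup>2)"
      by (intro summable_suminf_not_top) auto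
    from summable_LIMSEQ_zero[OF this] have "(\<lambda>n. norm (Y n x)) \<longlonglongrightarrow> 0"
      by simp
    then show ?case by (rule tendsto_norm_zero_cancel)
  qed
qed

lemma (in prob_space) AE_average_partial_products_tendsto_zero:
  fixes Z :: "nat \<Rightarrow> 'a \<Rightarrow> complex"
  assumes indep: "indep_vars (\<lambda>_. borel) Z {1..}"
    and norm_Z: "\<And>i x. norm (Z i x) = 1"
    and mean: "\<And>i. i \<ge> 1 \<Longrightarrow> expectation (Z i) = \<phi>"
    and \<phi>: "\<phi> \<noteq> 1"
  shows "AE x in M. (\<lambda>N. (\<Sum>n=1..N. \<Prod>i=1..n. Z i x) / of_nat N) \<longlonglongrightarrow> 0"
proof -
  define W where "W n x = (\<Prod>i=1..n. Z i x)" for n x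
  define A where "A N x = (\<Sum>n=1..N. W n x)" for N x
  have Z_meas: "Z i \<in> borel_measurable M" if "i \<ge> 1" for i
    using indep that by (auto simp: indep_vars_def)
  have [measurable]: "W n \<in> borel_measurable M" for n
    unfolding W_def by (intro borel_measurable_prod Z_meas) auto
  have [measurable]: "A N \<in> borel_measurable M" for N
    unfolding A_def by measurable
  have [measurable]: "cnj \<in> borel_measurable borel"
    by (intro borel_measurable_continuous_onI continuous_intros)
  have norm_W: "norm (W n x) = 1" for n x
    by (simp add: W_def prod_norm[symmetric] norm_Z)
  have norm_A: "norm (A N x) \<le> N" for N x
    unfolding A_def using sum_norm_le[of "{1..N}" "\<lambda>n. W n x" "\<lambda>_. 1"] norm_W by simp
  have Z_int: "integrable M (Z i)" if "i \<ge> 1" for i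
    by (rule integrable_const_bound[of _ 1]) (simp_all add: norm_Z Z_meas[OF that])
  have WW_int: "integrable M (\<lambda>x. W m x * cnj (W n x))" for m n
    by (rule integrable_const_bound[of _ 1]) (auto simp: norm_mult norm_W)
  have A_int: "integrable M (\<lambda>x. (norm (A N x))\<^sup>2)" for N
    by (rule integrable_const_bound[of _ "N^2"]) (auto intro!: power_mono norm_A)
  have norm_\<phi>: "norm \<phi> \<le> 1"
    using integral_norm_bound[of M "Z 1"] mean[of 1] by (simp add: norm_Z prob_space)
  define C where "C = 2 / norm (1 - \<phi>)"
  have EWW: "expectation (\<lambda>x. W m x * cnj (W n x)) = \<phi> ^ (m - n)" if "n \<le> m" for m n
  proof -
    \<comment> \<open>The first n factors have modulus one and cancel against their conjugates; the
      remaining m - n are independent with mean \<phi>.\<close>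
    have "W m x * cnj (W n x) = (\<Prod>i\<in>{n<..m}. Z i x)" for x
    proof -
      have "W m x = W n x * (\<Prod>i\<in>{n<..m}. Z i x)"
        unfolding W_def using that
        by (subst prod.union_disjoint[symmetric]) (auto intro!: prod.cong)
      moreover have "W n x * cnj (W n x) = 1"
        using norm_W[of n x] by (simp flip: complex_norm_square)
      ultimately show ?thesis by (simp add: mult_ac)
    qed
    then have "expectation (\<lambda>x. W m x * cnj (W n x)) = expectation (\<lambda>x. \<Prod>i\<in>{n<..m}. Z i x)"
      by simp
    also have "\<dots> = (\<Prod>i\<in>{n<..m}. expectation (Z i))"
      by (intro indep_vars_lebesgue_integral indep_vars_subset[OF indep] Z_int) auto
    also have "\<dots> = (\<Prod>i\<in>{n<..m}. \<phi>)" by (intro prod.cong mean) auto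
    finally show ?thesis by simp
  qed
  have cross: "norm (expectation (\<lambda>x. W (Suc N) x * cnj (A N x))) \<le> C" for N
  proof -
    have "expectation (\<lambda>x. W (Suc N) x * cnj (A N x))
        = (\<Sum>n=1..N. expectation (\<lambda>x. W (Suc N) x * cnj (W n x)))"
      unfolding A_def cnj_sum sum_distrib_left by (intro Bochner_Integration.integral_sum WW_int)
    also have "\<dots> = (\<Sum>n=1..N. \<phi> ^ (Suc N - n))"
      by (intro sum.cong EWW) auto
    finally show ?thesis unfolding C_def using norm_sum_powers_le[OF norm_\<phi> \<phi>] by simp
  qed
  have WA_int: "integrable M (\<lambda>x. W (Suc N) x * cnj (A N x))" for N
    by (rule integrable_const_bound[of _ "N"]) (auto simp: norm_mult norm_W norm_A)
  \<comment> \<open>Passing from N to N + 1 adds 1 plus twice the real part of a cross term bounded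
    by \<open>C\<close>, so the growth is linear.\<close>
  have second_moment: "expectation (\<lambda>x. (norm (A N x))\<^sup>2) \<le> (1 + 2 * C) * N" for N
  proof (induction N)
    case 0
    then show ?case by (simp add: A_def)
  next
    case (Suc N)
    have "(norm (A (Suc N) x))\<^sup>2 = (norm (A N x))\<^sup>2 + (1 + 2 * Re (W (Suc N) x * cnj (A N x)))" for x
    proof -
      have "A (Suc N) x = A N x + W (Suc N) x" by (simp add: A_def)
      moreover have "(Re (W (Suc N) x))\<^sup>2 + (Im (W (Suc N) x))\<^sup>2 = 1"
        using norm_W[of "Suc N" x] by (simp flip: cmod_power2)
      ultimately show ?thesis
        unfolding cmod_power2 by (simp add: power2_eq_square algebra_simps)
    qed
    then have "expectation (\<lambda>x. (norm (A (Suc N) x))\<^sup>2)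
        = expectation (\<lambda>x. (norm (A N x))\<^sup>2) + (1 + 2 * Re (expectation (\<lambda>x. W (Suc N) x * cnj (A N x))))"
      using A_int[of N] WA_int[of N] integrable_Re[OF WA_int[of N]]
      by (simp add: prob_space del: times_complex.sel)
    also have "\<dots> \<le> (1 + 2 * C) * N + (1 + 2 * C)"
      using Suc cross[of N] complex_Re_le_cmod[of "expectation (\<lambda>x. W (Suc N) x * cnj (A N x))"]
      by linarith
    finally show ?case by (simp add: algebra_simps)
  qed
  have "AE x in M. (\<lambda>m. A (m\<^sup>2) x / of_nat (m\<^sup>2)) \<longlonglongrightarrow> 0"
  proof (rule AE_tendsto_zero_if_summable_second_moments)
    have eq: "(norm (A (m\<^sup>2) x / of_nat (m\<^sup>2)))\<^sup>2 = (norm (A (m\<^sup>2) x))\<^sup>2 / real m ^ 4" for m x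
      by (simp add: norm_divide norm_power power_divide)
    show "integrable M (\<lambda>x. (norm (A (m\<^sup>2) x / of_nat (m\<^sup>2)))\<^sup>2)" for m
      unfolding eq using A_int by simp
    \<comment> \<open>At N = m^2 the linear bound divided by N^2 = m^4 is of order 1/m^2; along all
      N it would be of order 1/N, which is not summable.\<close>
    show "summable (\<lambda>m. expectation (\<lambda>x. (norm (A (m\<^sup>2) x / of_nat (m\<^sup>2)))\<^sup>2))"
    proof (rule summable_comparison_test')
      show "summable (\<lambda>m. (1 + 2 * C) * inverse (real m ^ 2))"
        by (intro summable_mult inverse_power_summable) auto
      fix m :: nat assume "m \<ge> 1"
      have "expectation (\<lambda>x. (norm (A (m\<^sup>2) x))\<^sup>2) / real m ^ 4 \<le> (1 + 2 * C) * real (m\<^sup>2) / real m ^ 4"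
        using second_moment[of "m\<^sup>2"] by (intro divide_right_mono) auto
      also have "\<dots> = (1 + 2 * C) * inverse (real m ^ 2)"
        using \<open>m \<ge> 1\<close> by (simp add: field_simps power2_eq_square power4_eq_xxxx)
      finally show "norm (expectation (\<lambda>x. (norm (A (m\<^sup>2) x / of_nat (m\<^sup>2)))\<^sup>2)) \<le> (1 + 2 * C) * inverse (real m ^ 2)"
        unfolding eq by simp
    qed
  qed measurable
  then show ?thesis
  proof eventually_elim
    case (elim x)
    then show ?case
      using averages_tendsto_zero_if_square_subsequence[of "\<lambda>n. W n x"] norm_W
      by (simp add: A_def W_def)
  qed
qed

section \<open>Application to the coin-tossing space\<close>

text \<open>The joint law of the coordinates is the product measure itself, and its marginals are
  the factors, so joint law and product of marginals agree.\<close>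

lemma indep_vars_PiM_component:
  assumes M: "\<And>i. i \<in> I \<Longrightarrow> prob_space (M i)" and I: "I \<noteq> {}"
  shows "prob_space.indep_vars (PiM I M) M (\<lambda>i \<omega>. \<omega> i) I"
proof -
  interpret P: prob_space "PiM I M" by (intro prob_space_PiM M)
  have "distr (PiM I M) (PiM I M) (\<lambda>\<omega>. \<lambda>i\<in>I. \<omega> i) = distr (PiM I M) (PiM I M) (\<lambda>\<omega>. \<omega>)"
    by (intro distr_cong) (auto simp: space_PiM)
  also have "\<dots> = PiM I (\<lambda>i. distr (PiM I M) (M i) (\<lambda>\<omega>. \<omega> i))"
    by (auto simp: distr_id intro!: PiM_cong distr_PiM_component[symmetric] M)
  finally show ?thesis
    using I by (subst P.indep_vars_iff_distr_eq_PiM') auto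
qed

lemma AE_Weyl_sums_tendsto_zero:
  fixes h :: int
  assumes ab: "\<alpha> \<notin> \<rat> \<or> \<beta> \<notin> \<rat>" and h: "h \<noteq> 0"
  shows "AE x in coin_measure.
    (\<lambda>N. (\<Sum>n=1..N. cis (2 * pi * h * partial_sum \<alpha> \<beta> n x)) / of_nat N) \<longlonglongrightarrow> 0"
proof -
  have U: "prob_space (uniform_count_measure {1, 2::nat})"
    by (intro prob_space_uniform_count_measure) auto
  interpret prob_space coin_measure
    unfolding coin_measure_def by (intro prob_space_PiM U)
  define e where "e t = cis (2 * pi * h * t)" for t
  define \<phi> where "\<phi> = (e \<alpha> + e \<beta>) / 2"
  \<comment> \<open>Real part 1 forces h t to be an integer, and h is nonzero.\<close>
  have e1: "t \<in> \<rat>" if "Re (e t) = 1" for t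
  proof -
    have "cos (2 * pi * h * t) = 1" using that by (simp add: e_def)
    then obtain k :: int where "2 * pi * h * t = k * 2 * pi"
      unfolding cos_one_2pi_int by auto
    then have "t = of_int k / of_int h" using h by (simp add: field_simps)
    then show ?thesis by simp
  qed
  \<comment> \<open>A midpoint of two points of the unit circle is 1 only if both are 1, which would
    make \<alpha> and \<beta> rational.\<close>
  have "\<phi> \<noteq> 1"
  proof
    assume "\<phi> = 1"
    then have "Re (e \<alpha>) + Re (e \<beta>) = 2" by (auto simp: \<phi>_def complex_eq_iff)
    moreover have "Re (e \<alpha>) \<le> 1" "Re (e \<beta>) \<le> 1" by (auto simp: e_def)
    ultimately show False using e1 ab by force
  qed
  have "AE x in coin_measure. (\<lambda>N. (\<Sum>n=1..N. \<Prod>i=1..n. e (step \<alpha> \<beta> i x)) / of_nat N) \<longlonglongrightarrow> 0"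
  proof (rule AE_average_partial_products_tendsto_zero[OF _ _ _ \<open>\<phi> \<noteq> 1\<close>])
    \<comment> \<open>Every subset of {1, 2} is measurable.\<close>
    have meas: "(\<lambda>k. e (if k = 1 then \<alpha> else \<beta>)) \<in> borel_measurable (uniform_count_measure {1, 2::nat})"
      by (simp add: measurable_def sets_uniform_count_measure space_uniform_count_measure)
    show "indep_vars (\<lambda>_. borel) (\<lambda>i x. e (step \<alpha> \<beta> i x)) {1..}"
      unfolding step_def using U meas unfolding coin_measure_def 
      by (intro prob_space.indep_vars_compose2[OF _ indep_vars_PiM_component] prob_space_PiM) auto
    fix i :: nat assume i: "i \<ge> 1"
    have "expectation (\<lambda>x. e (step \<alpha> \<beta> i x))
        = integral\<^sup>L (distr coin_measure (uniform_count_measure {1, 2::nat}) (\<lambda>x. x i)) (\<lambda>k. e (if k = 1 then \<alpha> else \<beta>))"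
      unfolding step_def using i by (subst integral_distr) (auto simp: coin_measure_def meas)
    also have "distr coin_measure (uniform_count_measure {1, 2::nat}) (\<lambda>x. x i) = uniform_count_measure {1, 2}"
      unfolding coin_measure_def using i U by (subst distr_PiM_component) auto
    also have "integral\<^sup>L (uniform_count_measure {1, 2::nat}) (\<lambda>k. e (if k = 1 then \<alpha> else \<beta>)) = \<phi>"
      unfolding uniform_count_measure_def
      by (subst lebesgue_integral_point_measure_finite)
        (auto simp: \<phi>_def scaleR_conv_of_real field_simps)
    finally show "expectation (\<lambda>x. e (step \<alpha> \<beta> i x)) = \<phi>" .
  qed (simp add: e_def)
  moreover have "(\<Prod>i=1..n. e (step \<alpha> \<beta> i x)) = cis (2 * pi * h * partial_sum \<alpha> \<beta> n x)" for n x
    by (induction n) (auto simp: e_def partial_sum_def cis_mult algebra_simps)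
  ultimately show ?thesis by simp
qed

theorem theorem1p1:
  fixes \<alpha> \<beta> :: real
  assumes "\<alpha> \<in> {0<..<1}" and "\<beta> \<in> {0<..<1}"
    and "\<alpha> \<notin> \<rat> \<or> \<beta> \<notin> \<rat>"
  shows "AE x in coin_measure.
           uniformly_distributed_mod_one (\<lambda>n. partial_sum \<alpha> \<beta> n x)"
proof -
  \<comment> \<open>There are only countably many \<open>h\<close>, so the exceptional null sets
    combine into one.\<close>
  have "AE x in coin_measure. \<forall>h::int. h \<noteq> 0 \<longrightarrow>
      (\<lambda>N. (\<Sum>n=1..N. cis (2 * pi * h * partial_sum \<alpha> \<beta> n x)) / of_nat N) \<longlonglongrightarrow> 0"
    unfolding AE_all_countable using AE_Weyl_sums_tendsto_zero[OF assms(3)] by simp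
  then show ?thesis
    by eventually_elim (blast intro: Weyl_criterion)
qed

end
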